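(* There is an absolute constant $c>0$ such that for every integer $d \geq 3$ there exist infinitely many $n$ for which there is an $n$-vertex graph $G$ whose local queue number is at most $d+2$ but whose queue number is at least $c\,\sqrt{d}\,n^{1/2-1/d}$ (that is, queue number $\Omega(\sqrt{d}\,n^{1/2-1/d})$).
   Context: Graphs are finite, simple and undirected. Given a linear ordering $\prec$ of the vertex set of a graph, two edges $uv$ and $xy$ nest if $u \prec x \prec y \prec v$ or $x \prec u \prec v \prec y$ (for the endpoints named suitably). A queue is a set of edges no two of which nest. A queue layout of $G$ consists of a linear ordering $\prec$ of $V(G)$ and a partition of $E(G)$ into queues; it is a $k$-queue layout if it uses $k$ queues, and it is $\ell$-local if every vertex has incident edges in at most $\ell$ queues (the total number of queues being arbitrary). The queue number of $G$ is the smallest $k$ such that $G$ has a $k$-queue layout. The local queue number of $G$ is the smallest $\ell$ such that $G$ has an $\ell$-local queue layout. *)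

theory Defs
  imports Complex_Main "HOL-Library.Disjoint_Sets" "HOL-Library.Ramsey"
begin

definition simple_graph :: "'a set \<Rightarrow> 'a set set \<Rightarrow> bool" where
  "simple_graph V E \<longleftrightarrow> finite V \<and> E \<subseteq> nsets V 2"

definition nest :: "'a rel \<Rightarrow> 'a set \<Rightarrow> 'a set \<Rightarrow> bool" where
  "nest r e f \<longleftrightarrow> (\<exists>u v x y. e = {u, v} \<and> f = {x, y} \<and>
     ((u, x) \<in> r \<and> (x, y) \<in> r \<and> (y, v) \<in> r \<or>
      (x, u) \<in> r \<and> (u, v) \<in> r \<and> (v, y) \<in> r))"

definition queue :: "'a rel \<Rightarrow> 'a set set \<Rightarrow> bool" where
  "queue r Q \<longleftrightarrow> (\<forall>e\<in>Q. \<forall>f\<in>Q. \<not> nest r e f)"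

(* The parts of a partition are nonempty, so card P counts the queues actually used.
   This does not affect the minima below. *)
definition queue_layout :: "'a set \<Rightarrow> 'a set set \<Rightarrow> 'a rel \<Rightarrow> 'a set set set \<Rightarrow> bool" where
  "queue_layout V E r P \<longleftrightarrow>
     strict_linear_order_on V r \<and> partition_on E P \<and> (\<forall>Q\<in>P. queue r Q)"

definition k_queue_layout :: "nat \<Rightarrow> 'a set \<Rightarrow> 'a set set \<Rightarrow> 'a rel \<Rightarrow> 'a set set set \<Rightarrow> bool" where
  "k_queue_layout k V E r P \<longleftrightarrow> queue_layout V E r P \<and> card P = k"

definition local_queue_layout :: "nat \<Rightarrow> 'a set \<Rightarrow> 'a set set \<Rightarrow> 'a rel \<Rightarrow> 'a set set set \<Rightarrow> bool" where
  "local_queue_layout l V E r P \<longleftrightarrow>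
     queue_layout V E r P \<and> (\<forall>v\<in>V. card {Q \<in> P. \<exists>e\<in>Q. v \<in> e} \<le> l)"

definition queue_number :: "'a set \<Rightarrow> 'a set set \<Rightarrow> nat" where
  "queue_number V E = (LEAST k. \<exists>r P. k_queue_layout k V E r P)"

definition local_queue_number :: "'a set \<Rightarrow> 'a set set \<Rightarrow> nat" where
  "local_queue_number V E = (LEAST l. \<exists>r P. local_queue_layout l V E r P)"

(* Every graph has a queue layout, so both minima above are taken over nonempty sets. *)
lemma queue_layout_exists:
  assumes "simple_graph V E"
  shows "\<exists>r P. queue_layout V E r P"
proof -
  obtain w where "well_order_on V w"
    using well_order_on by blast
  then have r: "strict_linear_order_on V (w - Id)"
    using strict_linear_order_on_diff_Id by (auto simp: well_order_on_def)
  then have "trans (w - Id)" and "irrefl (w - Id)"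
    by (auto simp: strict_linear_order_on_def)
  then have "\<not> nest (w - Id) e e" for e
    unfolding nest_def by (auto simp: doubleton_eq_iff irrefl_def dest: transD)
  then have "queue_layout V E (w - Id) ((\<lambda>e. {e}) ` E)"
    using r by (auto simp: queue_layout_def queue_def partition_on_def disjoint_def)
  then show ?thesis by blast
qed

lemma queue_number_attained:
  assumes "simple_graph V E"
  shows "\<exists>r P. k_queue_layout (queue_number V E) V E r P"
  unfolding queue_number_def
  by (rule LeastI_ex) (use queue_layout_exists[OF assms] in \<open>auto simp: k_queue_layout_def\<close>)

lemma local_queue_number_attained:
  assumes "simple_graph V E"
  shows "\<exists>r P. local_queue_layout (local_queue_number V E) V E r P"
  unfolding local_queue_number_def
proof (rule LeastI_ex)
  obtain r P where rP: "queue_layout V E r P"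
    using queue_layout_exists[OF assms] by blast
  have "finite V" using assms by (simp add: simple_graph_def)
  then have "local_queue_layout (\<Sum>v\<in>V. card {Q \<in> P. \<exists>e\<in>Q. v \<in> e}) V E r P"
    using rP by (auto simp: local_queue_layout_def intro: member_le_sum)
  then show "\<exists>l r P. local_queue_layout l V E r P" by blast
qed

end

(* Fix disjoint sets A, B of n vertices each and let every a in A choose d neighbours in B.
   The star of each vertex of B is a queue, so such a graph has local queue number at most d.

   For the lower bound we count choices, following Malitz and Wood. Fix a vertex ordering, cut it
   into N blocks of s consecutive vertices, and send an edge to the pair of blocks containing its
   left and right end. The edges of a queue then lie in a chain of the product order on the
   N x N grid, hence on a monotone lattice path of at most 2N cells. Thus k queues lie in one of
   at most 4^(Nk) sets of at most 2Nk cells, which contain at most M = 2Nks^2 edges. By AM-GM at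
   most (M/n)^(dn) choices have all their edges there. With at most (2n)^(2n) orderings and
   s close to 2k/d, this accounts for fewer than n^(dn) choices as long as
   k <= sqrt d (2n)^(1/2-1/d) / 128. *)
theory Submission
  imports Defs
begin

section \<open>Covering the chains of a grid by few sets of cells\<close>

text \<open>Both inequalities are weak, since two edges may share an end or have ends in the same
  block.\<close>

definition grid_chain :: "(nat \<times> nat) set \<Rightarrow> bool" where
  "grid_chain C \<longleftrightarrow> (\<forall>i j i' j'. (i, j) \<in> C \<longrightarrow> (i', j') \<in> C \<longrightarrow>
     i \<le> i' \<and> j \<le> j' \<or> i' \<le> i \<and> j' \<le> j)"

lemma grid_chain_subset: "grid_chain C \<Longrightarrow> C' \<subseteq> C \<Longrightarrow> grid_chain C'"
  unfolding grid_chain_def by blast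

definition covers_chains :: "(nat \<times> nat) set set \<Rightarrow> nat \<Rightarrow> nat \<Rightarrow> bool" where
  "covers_chains F p q \<longleftrightarrow> (\<forall>C. grid_chain C \<longrightarrow> C \<subseteq> {..p} \<times> {..q} \<longrightarrow> (\<exists>P\<in>F. C \<subseteq> P))"

text \<open>Apart from the corner \<open>(p, q)\<close>, a chain cannot contain both a cell with
  first coordinate \<open>p\<close> and one with second coordinate \<open>q\<close>, because these
  are incomparable. So it fits into the grid shortened in one direction, and the corner is put back
  afterwards. The guards \<open>p > 0\<close> and \<open>q > 0\<close> are there because
  \<open>0 - 1 = 0\<close> in \<open>nat\<close>.\<close>

lemma covers_chains_step:
  assumes "p + q > 0"
    and F: "p > 0 \<Longrightarrow> covers_chains F (p - 1) q"
    and G: "q > 0 \<Longrightarrow> covers_chains G p (q - 1)"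
  shows "covers_chains (insert (p, q) ` (F \<union> G)) p q"
  unfolding covers_chains_def
proof (intro allI impI)
  fix C assume C: "grid_chain C" "C \<subseteq> {..p} \<times> {..q}"
  define C' where "C' = C - {(p, q)}"
  have chain: "grid_chain C'"
    using C(1) grid_chain_subset unfolding C'_def by blast
  have "(p > 0 \<and> C' \<subseteq> {..p - 1} \<times> {..q}) \<or> (q > 0 \<and> C' \<subseteq> {..p} \<times> {..q - 1})"
  proof (rule ccontr)
    assume neg: "\<not> ?thesis"
    have sub: "C' \<subseteq> {..p} \<times> {..q}" "(p, q) \<notin> C'" using C(2) by (auto simp: C'_def)
    have 1: "p = 0 \<or> (\<exists>j. (p, j) \<in> C' \<and> j < q)"
    proof (rule disjCI)
      assume no: "\<not> (\<exists>j. (p, j) \<in> C' \<and> j < q)"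
      have "C' \<subseteq> {..p - 1} \<times> {..q}"
      proof
        fix x assume x: "x \<in> C'"
        obtain i j where [simp]: "x = (i, j)" by (cases x)
        have "i \<le> p" "j \<le> q" using sub x by auto
        moreover have "i \<noteq> p"
        proof
          assume "i = p"
          then have "j \<noteq> q" using x sub by auto
          then show False using no x \<open>i = p\<close> \<open>j \<le> q\<close> by auto
        qed
        ultimately show "x \<in> {..p - 1} \<times> {..q}" by simp
      qed
      then show "p = 0" using neg by auto
    qed
    have 2: "q = 0 \<or> (\<exists>i. (i, q) \<in> C' \<and> i < p)"
    proof (rule disjCI)
      assume no: "\<not> (\<exists>i. (i, q) \<in> C' \<and> i < p)"
      have "C' \<subseteq> {..p} \<times> {..q - 1}"
      proof
        fix x assume x: "x \<in> C'"
        obtain i j where [simp]: "x = (i, j)" by (cases x)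
        have "i \<le> p" "j \<le> q" using sub x by auto
        moreover have "j \<noteq> q"
        proof
          assume "j = q"
          then have "i \<noteq> p" using x sub by auto
          then show False using no x \<open>j = q\<close> \<open>i \<le> p\<close> by auto
        qed
        ultimately show "x \<in> {..p} \<times> {..q - 1}" by simp
      qed
      then show "q = 0" using neg by auto
    qed
    \<comment> \<open>If \<open>p = 0\<close>, then no \<open>i < p\<close> exists, so fact 2 leaves
      only \<open>q = 0\<close>, against \<open>p + q > 0\<close>. The case \<open>q = 0\<close> is
      symmetric, so both witnesses exist.\<close>
    from 1 2 assms(1) obtain i j where "(p, j) \<in> C'" "j < q" "(i, q) \<in> C'" "i < p"
      by auto
    then have "i \<le> p \<and> q \<le> j \<or> p \<le> i \<and> j \<le> q" "j < q" "i < p"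
      using chain unfolding grid_chain_def by blast+
    then show False by simp
  qed
  then have "\<exists>P\<in>F \<union> G. C' \<subseteq> P"
  proof
    assume *: "p > 0 \<and> C' \<subseteq> {..p - 1} \<times> {..q}"
    then have "covers_chains F (p - 1) q" using F by metis
    then have "\<exists>P\<in>F. C' \<subseteq> P" using conjunct2[OF *] chain unfolding covers_chains_def by metis
    then show ?thesis by blast
  next
    assume *: "q > 0 \<and> C' \<subseteq> {..p} \<times> {..q - 1}"
    then have "covers_chains G p (q - 1)" using G by metis
    then have "\<exists>P\<in>G. C' \<subseteq> P" using conjunct2[OF *] chain unfolding covers_chains_def by metis
    then show ?thesis by blast
  qed
  then obtain P where P: "P \<in> F \<union> G" "C' \<subseteq> P" by blast
  then have "C \<subseteq> insert (p, q) P" unfolding C'_def by blast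
  then show "\<exists>P\<in>insert (p, q) ` (F \<union> G). C \<subseteq> P"
    using P(1) by (rule bexI[OF _ imageI])
qed

text \<open>This is the recursion for monotone lattice paths ending in \<open>(p, q)\<close>: two
  possible predecessors double the family, and the corner adds one cell.\<close>

lemma chain_cover_exists:
  "\<exists>F. finite F \<and> card F \<le> 2 ^ (p + q) \<and> (\<forall>P\<in>F. finite P \<and> card P \<le> p + q + 1) \<and> covers_chains F p q"
proof (induction "p + q" arbitrary: p q)
  case 0
  then show ?case
    by (intro exI[of _ "{{(0, 0)}}"]) (auto simp: covers_chains_def)
next
  case (Suc m)
  let ?good = "\<lambda>F. finite F \<and> card F \<le> 2 ^ m \<and> (\<forall>P\<in>F. finite P \<and> card P \<le> m + 1)"
  \<comment> \<open>For \<open>p = 0\<close> there is no predecessor in this direction, and the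
    empty family serves.\<close>
  have "\<exists>F. ?good F \<and> (p > 0 \<longrightarrow> covers_chains F (p - 1) q)"
  proof (cases "p > 0")
    case True
    then have "m = p - 1 + q" using Suc.hyps(2) by simp
    with Suc.hyps(1)[OF this] show ?thesis by auto
  qed (auto intro: exI[of _ "{}"])
  then obtain F where F: "?good F" "p > 0 \<Longrightarrow> covers_chains F (p - 1) q" by blast
  have "\<exists>G. ?good G \<and> (q > 0 \<longrightarrow> covers_chains G p (q - 1))"
  proof (cases "q > 0")
    case True
    then have "m = p + (q - 1)" using Suc.hyps(2) by simp
    with Suc.hyps(1)[OF this] show ?thesis by auto
  qed (auto intro: exI[of _ "{}"])
  then obtain G where G: "?good G" "q > 0 \<Longrightarrow> covers_chains G p (q - 1)" by blast
  have "card (insert (p, q) ` (F \<union> G)) \<le> card (F \<union> G)"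
    using F G by (intro card_image_le) auto
  also have "\<dots> \<le> card F + card G" by (rule card_Un_le)
  also have "\<dots> \<le> 2 ^ (p + q)" using F G Suc.hyps(2)[symmetric] by simp
  finally have "card (insert (p, q) ` (F \<union> G)) \<le> 2 ^ (p + q)" .
  moreover have "covers_chains (insert (p, q) ` (F \<union> G)) p q"
    using Suc.hyps(2) F G by (intro covers_chains_step) auto
  moreover have "finite P \<and> card P \<le> p + q + 1" if P: "P \<in> insert (p, q) ` (F \<union> G)" for P
  proof -
    obtain P' where P': "P' \<in> F \<union> G" "P = insert (p, q) P'" using P by blast
    then have "finite P'" "card P' \<le> m + 1" using F(1) G(1) by blast+
    moreover have "card P \<le> Suc (card P')" unfolding P'
      using \<open>finite P'\<close> by (simp add: card_insert_if)
    ultimately show ?thesis using P'(2) Suc.hyps(2)[symmetric] by simp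
  qed
  ultimately show ?case
    using F(1) G(1) by (intro exI[of _ "insert (p, q) ` (F \<union> G)"]) blast
qed

text \<open>Each of the \<open>k\<close> chains gets its own member of the cover for the
  \<open>N\<close> by \<open>N\<close> grid, and the union of these members is taken. The exponent
  \<open>2 * N - 2\<close> and the size \<open>2 * N - 1\<close> are rounded up to
  \<open>2 * N\<close>.\<close>

lemma chains_cover_exists:
  assumes "N > 0"
  shows "\<exists>F. finite F \<and> card F \<le> 4 ^ (N * k) \<and> (\<forall>P\<in>F. finite P \<and> card P \<le> 2 * N * k) \<and>
    (\<forall>\<C>. finite \<C> \<longrightarrow> card \<C> \<le> k \<longrightarrow> (\<forall>C\<in>\<C>. grid_chain C \<and> C \<subseteq> {..<N} \<times> {..<N}) \<longrightarrow>
      (\<exists>P\<in>F. \<Union>\<C> \<subseteq> P))"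
proof -
  obtain F where F: "finite F" "card F \<le> 2 ^ (N - 1 + (N - 1))"
      "\<And>P. P \<in> F \<Longrightarrow> finite P \<and> card P \<le> N - 1 + (N - 1) + 1" "covers_chains F (N - 1) (N - 1)"
    using chain_cover_exists[of "N - 1" "N - 1"] by blast
  have "card F \<le> 2 ^ (2 * N)"
    using F(2) by (rule order_trans) (intro power_increasing, auto)
  then have cF: "card F \<le> 4 ^ N" by (simp add: power_mult)
  let ?W = "PiE {..<k} (\<lambda>_. F)"
  let ?U = "(\<lambda>g. \<Union>i<k. g i) ` ?W"
  have fW: "finite ?W" using F by (intro finite_PiE) auto
  have "card ?U \<le> card ?W" by (rule card_image_le[OF fW])
  also have "\<dots> = card F ^ k" by (simp add: card_PiE)
  also have "\<dots> \<le> (4 ^ N) ^ k" by (intro power_mono cF) auto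
  finally have "card ?U \<le> 4 ^ (N * k)" by (simp add: power_mult)
  moreover have "finite P \<and> card P \<le> 2 * N * k" if "P \<in> ?U" for P
  proof -
    obtain g where g: "g \<in> ?W" "P = (\<Union>i<k. g i)" using \<open>P \<in> ?U\<close> by (elim imageE)
    have gi: "finite (g i) \<and> card (g i) \<le> 2 * N" if "i < k" for i
    proof -
      have "g i \<in> F" using g that by auto
      from F(3)[OF this] show ?thesis using assms by auto
    qed
    have "card P \<le> (\<Sum>i<k. card (g i))" unfolding g by (rule card_UN_le) simp
    also have "\<dots> \<le> (\<Sum>i<k. 2 * N)" by (rule sum_mono) (use gi in auto)
    finally show ?thesis using gi g by (auto simp: mult_ac)
  qed
  moreover have "\<exists>P\<in>?U. \<Union>\<C> \<subseteq> P"
    if \<C>: "finite \<C>" "card \<C> \<le> k" "\<forall>C\<in>\<C>. grid_chain C \<and> C \<subseteq> {..<N} \<times> {..<N}" for \<C>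
  proof -
    obtain h where h: "bij_betw h {0..<card \<C>} \<C>" using ex_bij_betw_nat_finite[OF \<C>(1)] by blast
    \<comment> \<open>The empty chain is included to pad a family of fewer than \<open>k\<close>
      chains to exactly \<open>k\<close> indices.\<close>
    have "\<exists>P\<in>F. C \<subseteq> P" if "C \<in> \<C> \<or> C = {}" for C
    proof -
      have "{..<N} = {..N - 1}" using assms by auto
      then have "C \<subseteq> {..N - 1} \<times> {..N - 1}" using that \<C>(3) by auto
      moreover have "grid_chain C" using that \<C>(3) by (auto simp: grid_chain_def[of "{}"])
      ultimately show ?thesis using F(4) by (auto simp: covers_chains_def)
    qed
    then obtain c where c: "\<And>C. C \<in> \<C> \<or> C = {} \<Longrightarrow> c C \<in> F \<and> C \<subseteq> c C" by metis
    define g where "g = (\<lambda>i\<in>{..<k}. c (if i < card \<C> then h i else {}))"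
    have mem: "(if i < card \<C> then h i else {}) \<in> \<C> \<or> (if i < card \<C> then h i else {}) = {}" for i
      using bij_betwE[OF h] by auto
    have "g \<in> ?W" using c[OF mem] by (auto simp: g_def)
    moreover have "\<Union>\<C> \<subseteq> (\<Union>i<k. g i)"
    proof
      fix x assume "x \<in> \<Union>\<C>"
      then obtain C where "C \<in> \<C>" "x \<in> C" by blast
      moreover obtain i where "i < card \<C>" "h i = C"
        using h \<open>C \<in> \<C>\<close> unfolding bij_betw_def by (metis atLeastLessThan_iff imageE)
      ultimately have "x \<in> g i" "i < k" using c[OF mem[of i]] \<C>(2) by (auto simp: g_def)
      then show "x \<in> (\<Union>i<k. g i)" by blast
    qed
    ultimately show ?thesis by blast
  qed
  ultimately show ?thesis using fW by (intro exI[of _ ?U]) blast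
qed

section \<open>Edges as cells of the block grid\<close>

text \<open>Here \<open>f\<close> stands for the position in the vertex ordering, so
  \<open>Min\<close> and \<open>Max\<close> pick the left and right end of an edge, and
  \<open>div s\<close> gives the block.\<close>

definition cell :: "('a \<Rightarrow> nat) \<Rightarrow> nat \<Rightarrow> 'a set \<Rightarrow> nat \<times> nat" where
  "cell f s e = (Min (f ` e) div s, Max (f ` e) div s)"

lemma cell_doubleton: "cell f s {u, v} = (min (f u) (f v) div s, max (f u) (f v) div s)"
  by (simp add: cell_def)

text \<open>If two edges do not nest, their left ends and their right ends compare in the same
  direction, possibly with ties. Division by \<open>s\<close> is monotone and keeps this.\<close>

lemma queue_cells_chain:
  assumes r: "\<And>u v. u \<in> V \<Longrightarrow> v \<in> V \<Longrightarrow> (u, v) \<in> r \<longleftrightarrow> f u < f v"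
    and f: "inj_on f V" and Q: "queue r Q" "Q \<subseteq> nsets V 2"
  shows "grid_chain (cell f s ` Q)"
proof -
  have ends: "\<exists>u v. e = {u, v} \<and> u \<in> V \<and> v \<in> V \<and> f u < f v" if e: "e \<in> Q" for e
  proof -
    have "e \<in> nsets V 2" using e Q by blast
    then obtain u v where "e = {u, v}" "u \<noteq> v" "u \<in> V" "v \<in> V"
      by (auto simp: nsets_def card_2_iff)
    moreover then have "f u \<noteq> f v" using f by (auto dest: inj_onD)
    ultimately show ?thesis by (metis insert_commute linorder_neqE_nat)
  qed
  have "fst (cell f s e) \<le> fst (cell f s e') \<and> snd (cell f s e) \<le> snd (cell f s e') \<or>
      fst (cell f s e') \<le> fst (cell f s e) \<and> snd (cell f s e') \<le> snd (cell f s e)"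
    if e: "e \<in> Q" "e' \<in> Q" for e e'
  proof -
    obtain u v where uv: "e = {u, v}" "u \<in> V" "v \<in> V" "f u < f v" using ends e by blast
    obtain x y where xy: "e' = {x, y}" "x \<in> V" "y \<in> V" "f x < f y" using ends e by blast
    have "\<not> nest r e e'" using Q e by (auto simp: queue_def)
    then have "\<not> (f u < f x \<and> f y < f v)" "\<not> (f x < f u \<and> f v < f y)"
      using uv xy r unfolding nest_def by blast+
    then have "f u \<le> f x \<and> f v \<le> f y \<or> f x \<le> f u \<and> f y \<le> f v" by linarith
    then show ?thesis using uv xy by (auto simp: cell_doubleton div_le_mono)
  qed
  then show ?thesis unfolding grid_chain_def image_iff by (metis fst_conv snd_conv)
qed

text \<open>The cell together with the offsets of both ends inside their blocks determines the two
  positions, and there are \<open>s\<close> values for each offset.\<close>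

lemma card_edges_in_cells:
  fixes f :: "'a \<Rightarrow> nat"
  assumes "finite G" "s > 0" "inj_on f (A \<union> B)" "A \<inter> B = {}"
  shows "card {(a, b) \<in> A \<times> B. cell f s {a, b} \<in> G} \<le> card G * s\<^sup>2"
proof -
  let ?S = "{(a, b) \<in> A \<times> B. cell f s {a, b} \<in> G}"
  let ?h = "\<lambda>(a, b). (cell f s {a, b}, min (f a) (f b) mod s, max (f a) (f b) mod s)"
  have "inj_on ?h ?S"
  proof (rule inj_onI, clarify)
    fix a b a' b'
    assume ab: "a \<in> A" "b \<in> B" "a' \<in> A" "b' \<in> B"
      and *: "cell f s {a, b} = cell f s {a', b'}"
        "min (f a) (f b) mod s = min (f a') (f b') mod s"
        "max (f a) (f b) mod s = max (f a') (f b') mod s"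
    have "min (f a) (f b) = min (f a') (f b')" "max (f a) (f b) = max (f a') (f b')"
      using * unfolding cell_doubleton by (metis div_mult_mod_eq prod.inject)+
    then have "f a = f a' \<and> f b = f b' \<or> f a = f b' \<and> f b = f a'"
      by (auto simp: min_def max_def split: if_splits)
    \<comment> \<open>Disjointness of \<open>A\<close> and \<open>B\<close> rules out that the two
      ends are swapped.\<close>
    moreover have "f a \<noteq> f b'" using ab assms by (metis UnCI disjoint_iff inj_onD)
    ultimately show "a = a' \<and> b = b'" using ab assms(3) by (auto dest: inj_onD)
  qed
  moreover have "?h ` ?S \<subseteq> G \<times> {..<s} \<times> {..<s}" using assms(2) by auto
  ultimately have "card ?S \<le> card (G \<times> {..<s} \<times> {..<s})"
    using assms(1) by (intro card_inj_on_le) auto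
  then show ?thesis by (simp add: card_cartesian_product power2_eq_square)
qed

text \<open>AM-GM, from \<open>t \<le> exp (t - 1)\<close> applied to each \<open>x a\<close>
  divided by the mean \<open>m\<close>: the exponents add up to at most 0. If \<open>M\<close> is
  not positive, all \<open>x a\<close> vanish and so does the product.\<close>

lemma prod_le_mean_power:
  fixes x :: "'a \<Rightarrow> real"
  assumes "finite A" "A \<noteq> {}" "\<And>a. a \<in> A \<Longrightarrow> x a \<ge> 0" "sum x A \<le> M"
  shows "prod x A \<le> (M / card A) ^ card A"
proof (cases "M > 0")
  case False
  obtain a where a: "a \<in> A" using assms(2) by blast
  have "sum x A = 0" "M = 0" using assms(3,4) sum_nonneg[of A x] False by auto
  then have "x a = 0" using assms a by (simp add: sum_nonneg_eq_0_iff)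
  then have "prod x A = 0" using a assms(1) by auto
  then show ?thesis using \<open>M = 0\<close> by simp
next
  case True
  define m where "m = M / card A"
  have c: "card A > 0" using assms by (simp add: card_gt_0_iff)
  then have m: "m > 0" using True by (simp add: m_def)
  have "prod (\<lambda>a. x a / m) A \<le> prod (\<lambda>a. exp (x a / m - 1)) A"
  proof (intro prod_mono conjI)
    fix a assume "a \<in> A"
    show "0 \<le> x a / m" using m assms(3)[OF \<open>a \<in> A\<close>] by simp
    show "x a / m \<le> exp (x a / m - 1)" using exp_ge_add_one_self[of "x a / m - 1"] by simp
  qed
  also have "\<dots> = exp (sum x A / m - card A)"
    by (simp add: exp_sum[OF assms(1), symmetric] sum_subtractf sum_divide_distrib)
  also have "sum x A / m \<le> M / m" using assms(4) m by (simp add: divide_right_mono)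
  then have "exp (sum x A / m - card A) \<le> 1" using True c by (simp add: m_def)
  finally have "prod x A / m ^ card A \<le> 1" by (simp add: prod_dividef)
  then show ?thesis using m by (simp add: m_def[symmetric])
qed

text \<open>The position of a vertex is the number of its predecessors. Orderings can then be
  counted as functions into \<open>{..<card V}\<close>.\<close>

lemma strict_linear_order_positions:
  assumes "finite V" "strict_linear_order_on V r"
  shows "\<exists>f\<in>PiE V (\<lambda>_. {..<card V}). inj_on f V \<and> (\<forall>u\<in>V. \<forall>v\<in>V. (u, v) \<in> r \<longleftrightarrow> f u < f v)"
proof -
  define f where "f = (\<lambda>v\<in>V. card {u \<in> V. (u, v) \<in> r})"
  have tr: "trans r" and irr: "\<And>x. (x, x) \<notin> r" and tot: "total_on V r"
    using assms(2) by (auto simp: strict_linear_order_on_def irrefl_def)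
  have less: "f u < f v" if "u \<in> V" "v \<in> V" "(u, v) \<in> r" for u v
  proof -
    have "{w \<in> V. (w, u) \<in> r} \<subset> {w \<in> V. (w, v) \<in> r}"
      using that irr transD[OF tr] by blast
    then show ?thesis using assms(1) that by (auto simp: f_def intro!: psubset_card_mono)
  qed
  have "f v < card V" if "v \<in> V" for v
    using that irr assms(1) by (auto simp: f_def intro!: psubset_card_mono)
  then have "f \<in> PiE V (\<lambda>_. {..<card V})" by (auto simp: f_def)
  moreover have "inj_on f V"
    using tot less unfolding inj_on_def total_on_def by (metis less_irrefl)
  moreover have "(u, v) \<in> r \<longleftrightarrow> f u < f v" if "u \<in> V" "v \<in> V" for u v
    using tot less that unfolding total_on_def by (metis less_asym)
  ultimately show ?thesis by blast
qed

section \<open>The random-like graphs and their local queue number\<close>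

text \<open>Choices are functions rather than \<open>d\<close>-subsets, so that they are independent
  and easy to count. Repeated values are allowed, hence vertices of \<open>A\<close> have degree at
  most \<open>d\<close>.\<close>

definition choice_graph :: "'a set \<Rightarrow> nat \<Rightarrow> ('a \<times> nat \<Rightarrow> 'a) \<Rightarrow> 'a set set" where
  "choice_graph A d F = (\<lambda>(a, i). {a, F (a, i)}) ` (A \<times> {..<d})"

lemma simple_graph_choice_graph:
  assumes "finite A" "finite B" "A \<inter> B = {}" "F \<in> A \<times> {..<d} \<rightarrow> B"
  shows "simple_graph (A \<union> B) (choice_graph A d F)"
proof -
  have "{a, F (a, i)} \<in> nsets (A \<union> B) 2" if "a \<in> A" "i < d" for a i
  proof -
    have "F (a, i) \<in> B" using assms that by auto
    then have "a \<noteq> F (a, i)" using assms(3) that(1) by (metis disjoint_iff)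
    then have "card {a, F (a, i)} = 2" by simp
    then show ?thesis using \<open>F (a, i) \<in> B\<close> that(1) by (simp add: nsets_def)
  qed
  then have "choice_graph A d F \<subseteq> nsets (A \<union> B) 2" by (auto simp: choice_graph_def)
  then show ?thesis using assms(1,2) by (simp add: simple_graph_def)
qed

text \<open>In a nesting pair each end of one edge is strictly comparable to each end of the other,
  so a common end would precede itself.\<close>

lemma edges_at_vertex_not_nest:
  assumes "irrefl r" "trans r" "b \<in> e" "b \<in> e'"
  shows "\<not> nest r e e'"
  using assms unfolding nest_def irrefl_def by (auto dest: transD)

text \<open>The stars of the vertices of \<open>B\<close> are queues under any ordering. A vertex of
  \<open>A\<close> meets at most \<open>d\<close> of them, a vertex of \<open>B\<close> only its
  own.\<close>

lemma local_queue_number_choice_graph: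
  fixes A B :: "'a::linorder set"
  assumes "finite A" "finite B" "A \<inter> B = {}" "F \<in> A \<times> {..<d} \<rightarrow> B" "d > 0"
  shows "local_queue_number (A \<union> B) (choice_graph A d F) \<le> d"
proof -
  let ?E = "choice_graph A d F"
  define r where "r = {(x::'a, y). x < y}"
  define star where "star b = {e \<in> ?E. b \<in> e}" for b
  \<comment> \<open>Only chosen vertices of \<open>B\<close> are used, so that no part is
    empty.\<close>
  let ?P = "star ` (F ` (A \<times> {..<d}))"
  have FB: "F ` (A \<times> {..<d}) \<subseteq> B" using assms(4) by auto
  have r: "irrefl r" "trans r" "total_on (A \<union> B) r"
    by (auto simp: r_def irrefl_def trans_def total_on_def)
  have edge: "e \<inter> B = {F (a, i)}" "e \<inter> A = {a}" if "e = {a, F (a, i)}" "a \<in> A" "i < d" for e a i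
    using that assms by auto
  have uniq: "b = b'" if e: "e \<in> ?E" and "b \<in> e" "b' \<in> e" "b \<in> B" "b' \<in> B" for e b b'
  proof -
    obtain a i where "e = {a, F (a, i)}" "a \<in> A" "i < d"
      using e by (auto simp: choice_graph_def)
    then have "e \<inter> B = {F (a, i)}" by (rule edge(1))
    then show ?thesis using that(2-5) by (metis IntI singletonD)
  qed
  have part: "partition_on ?E ?P"
  proof (rule partition_onI)
    have "e \<in> \<Union>?P" if "e \<in> ?E" for e
      using that by (auto simp: star_def choice_graph_def)
    then show "\<Union>?P = ?E" by (auto simp: star_def)
    have "star (F (a, i)) \<noteq> {}" if "a \<in> A" "i < d" for a i
    proof -
      have "{a, F (a, i)} \<in> star (F (a, i))" using that by (auto simp: star_def choice_graph_def)
      then show ?thesis by blast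
    qed
    then show "{} \<notin> ?P" by auto
    show "disjnt p p'" if p: "p \<in> ?P" "p' \<in> ?P" "p \<noteq> p'" for p p'
    proof -
      obtain b b' where b: "p = star b" "p' = star b'" "b \<in> B" "b' \<in> B"
        using p(1,2) FB by blast
      then have "b \<noteq> b'" using p(3) by auto
      have "e \<notin> star b'" if "e \<in> star b" for e
        using uniq[of e b b'] b(3,4) \<open>b \<noteq> b'\<close> that by (auto simp: star_def)
      then show ?thesis unfolding b disjnt_def by blast
    qed
  qed
  have "queue r Q" if "Q \<in> ?P" for Q
    using that edges_at_vertex_not_nest[OF r(1,2)] unfolding queue_def star_def by blast
  then have lay: "queue_layout (A \<union> B) ?E r ?P"
    using part r by (auto simp: queue_layout_def strict_linear_order_on_def)
  have "card {Q \<in> ?P. \<exists>e\<in>Q. v \<in> e} \<le> d" if "v \<in> A \<union> B" for v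
  proof (cases "v \<in> A")
    case True
    have "{Q \<in> ?P. \<exists>e\<in>Q. v \<in> e} \<subseteq> (\<lambda>i. star (F (v, i))) ` {..<d}"
    proof
      fix Q assume "Q \<in> {Q \<in> ?P. \<exists>e\<in>Q. v \<in> e}"
      then obtain e b where "e \<in> Q" "v \<in> e" "Q = star b" "b \<in> B"
        using FB by blast
      then have b: "Q = star b" "b \<in> B" "e \<in> ?E" "b \<in> e" "v \<in> e"
        by (auto simp: star_def)
      obtain a i where e: "e = {a, F (a, i)}" "a \<in> A" "i < d"
        using b(3) by (auto simp: choice_graph_def)
      have "v = a" "b = F (a, i)"
        using edge[OF e] b(2,4,5) True by (metis IntI singletonD)+
      then show "Q \<in> (\<lambda>i. star (F (v, i))) ` {..<d}" using b e by auto
    qed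
    then have "card {Q \<in> ?P. \<exists>e\<in>Q. v \<in> e} \<le> card ((\<lambda>i. star (F (v, i))) ` {..<d})"
      by (intro card_mono) auto
    also have "\<dots> \<le> d" using card_image_le[of "{..<d}"] by fastforce
    finally show ?thesis .
  next
    case False
    then have "v \<in> B" using that by auto
    have "Q = star v" if "Q \<in> ?P" "e \<in> Q" "v \<in> e" for Q e
    proof -
      obtain b where b: "b \<in> B" "Q = star b" using \<open>Q \<in> ?P\<close> FB by blast
      then have "e \<in> ?E" "b \<in> e" using that(2) by (auto simp: star_def)
      then have "b = v" using uniq b(1) \<open>v \<in> B\<close> that(3) by metis
      then show ?thesis using b by simp
    qed
    then have "{Q \<in> ?P. \<exists>e\<in>Q. v \<in> e} \<subseteq> {star v}" by blast
    then have "card {Q \<in> ?P. \<exists>e\<in>Q. v \<in> e} \<le> 1" using card_mono[of "{star v}"] by fastforce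
    then show ?thesis using assms(5) by simp
  qed
  then have "local_queue_layout d (A \<union> B) ?E r ?P"
    using lay by (simp add: local_queue_layout_def)
  then show ?thesis unfolding local_queue_number_def by (intro Least_le) blast
qed


section \<open>Counting the choices of small queue number\<close>

text \<open>This replaces an unknown layout by a pair of a position function and a member of a fixed
  family \<open>F\<close>, which makes the union bound possible.\<close>

lemma queue_number_cell_cover:
  assumes simple: "simple_graph V E" and qn: "queue_number V E \<le> k"
    and F: "\<forall>\<C>. finite \<C> \<longrightarrow> card \<C> \<le> k \<longrightarrow> (\<forall>C\<in>\<C>. grid_chain C \<and> C \<subseteq> {..<N} \<times> {..<N}) \<longrightarrow>
      (\<exists>P\<in>F. \<Union>\<C> \<subseteq> P)"
    and N: "card V \<le> N * s"
  shows "\<exists>f\<in>PiE V (\<lambda>_. {..<card V}). inj_on f V \<and> (\<exists>P\<in>F. cell f s ` E \<subseteq> P)"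
proof -
  have fin: "finite V" "E \<subseteq> nsets V 2" using simple by (auto simp: simple_graph_def)
  obtain r \<Q> where lay: "queue_layout V E r \<Q>" and card: "card \<Q> \<le> k"
    using queue_number_attained[OF simple] qn by (auto simp: k_queue_layout_def)
  then have part: "partition_on E \<Q>" and lin: "strict_linear_order_on V r"
    and queue: "\<And>Q. Q \<in> \<Q> \<Longrightarrow> queue r Q"
    by (auto simp: queue_layout_def)
  have "finite E" using fin finite_imp_finite_nsets finite_subset by blast
  then have "finite \<Q>" using part finite_elements by blast
  obtain f where f: "f \<in> PiE V (\<lambda>_. {..<card V})" "inj_on f V"
      "\<And>u v. u \<in> V \<Longrightarrow> v \<in> V \<Longrightarrow> (u, v) \<in> r \<longleftrightarrow> f u < f v"
    using strict_linear_order_positions[OF fin(1) lin] by blast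
  have block: "f v div s < N" if "v \<in> V" for v
  proof -
    have "f v < card V" using f(1) that by (simp add: PiE_iff)
    then have "f v < N * s" using N by linarith
    then show ?thesis by (simp add: less_mult_imp_div_less)
  qed
  have "cell f s e \<in> {..<N} \<times> {..<N}" if e: "e \<in> E" for e
  proof -
    have "e \<in> nsets V 2" using e fin by blast
    then obtain u v where "e = {u, v}" "u \<in> V" "v \<in> V"
      by (auto simp: nsets_def card_2_iff)
    then show ?thesis using block by (simp add: cell_doubleton min_def max_def)
  qed
  then have range: "cell f s ` E \<subseteq> {..<N} \<times> {..<N}" by (rule image_subsetI)
  have E: "E = \<Union>\<Q>" using part by (simp add: partition_on_def)
  let ?C = "(\<lambda>Q. cell f s ` Q) ` \<Q>"
  have "\<exists>P\<in>F. \<Union>?C \<subseteq> P"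
  proof (rule F[rule_format])
    show "finite ?C" using \<open>finite \<Q>\<close> by (rule finite_imageI)
    show "card ?C \<le> k" using card_image_le[OF \<open>finite \<Q>\<close>] card by (rule order_trans)
    fix C assume "C \<in> ?C"
    then obtain Q where Q: "Q \<in> \<Q>" "C = cell f s ` Q" by (elim imageE)
    then have sub: "Q \<subseteq> E" using E by (simp add: Union_upper)
    have "grid_chain C" unfolding Q(2)
      by (rule queue_cells_chain[OF f(3) f(2) queue[OF Q(1)] order_trans[OF sub fin(2)]])
    moreover have "C \<subseteq> {..<N} \<times> {..<N}"
      unfolding Q(2) using image_mono[OF sub] range by (rule order_trans)
    ultimately show "grid_chain C \<and> C \<subseteq> {..<N} \<times> {..<N}" ..
  qed
  moreover have "\<Union>?C = cell f s ` E" unfolding E by (simp only: image_Union)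
  ultimately show ?thesis using f(1,2) by auto
qed

text \<open>Each \<open>a\<close> makes \<open>d\<close> independent choices within
  \<open>?N a\<close>, so the count is at most the \<open>d\<close>-th power of the product of the
  sizes of the \<open>?N a\<close>, to which AM-GM applies.\<close>

lemma card_choices_in_cells:
  fixes n :: nat
  assumes "card A = n" "n > 0" "finite B" "A \<inter> B = {}" "s > 0" "inj_on f (A \<union> B)" "finite P" "card P \<le> M"
  shows "real (card {F \<in> PiE (A \<times> {..<d}) (\<lambda>_. B). cell f s ` choice_graph A d F \<subseteq> P})
    \<le> ((real (M * s\<^sup>2) / n) ^ d) ^ n"
proof -
  have A: "finite A" using assms(1,2) card_gt_0_iff by blast
  let ?N = "\<lambda>a. {b \<in> B. cell f s {a, b} \<in> P}"
  let ?X = "{F \<in> PiE (A \<times> {..<d}) (\<lambda>_. B). cell f s ` choice_graph A d F \<subseteq> P}"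
  have "?X \<subseteq> PiE (A \<times> {..<d}) (\<lambda>(a, i). ?N a)"
  proof
    fix F assume F: "F \<in> ?X"
    have "F (a, i) \<in> ?N a" if ai: "a \<in> A" "i < d" for a i
    proof -
      have "{a, F (a, i)} \<in> choice_graph A d F" using ai by (auto simp: choice_graph_def)
      then have "cell f s {a, F (a, i)} \<in> P" using F by blast
      moreover have "F (a, i) \<in> B" using F ai by auto
      ultimately show ?thesis by simp
    qed
    then show "F \<in> PiE (A \<times> {..<d}) (\<lambda>(a, i). ?N a)" using F by (auto simp: PiE_iff)
  qed
  then have "card ?X \<le> card (PiE (A \<times> {..<d}) (\<lambda>(a, i). ?N a))"
    using A assms(3) by (intro card_mono finite_PiE) auto
  also have "\<dots> = (\<Prod>(a, i)\<in>A \<times> {..<d}. card (?N a))"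
    using A by (subst card_PiE) (auto intro!: prod.cong)
  also have "\<dots> = (\<Prod>a\<in>A. card (?N a)) ^ d"
    by (simp add: prod.cartesian_product[symmetric] prod_power_distrib)
  finally have 1: "card ?X \<le> (\<Prod>a\<in>A. card (?N a)) ^ d" .
  \<comment> \<open>The sum counts the pairs in \<open>A\<close> and \<open>B\<close> whose cell
    lies in \<open>P\<close>.\<close>
  have "(\<Sum>a\<in>A. card (?N a)) = card (SIGMA a:A. ?N a)"
    using A assms(3) by (intro card_SigmaI[symmetric]) auto
  also have "(SIGMA a:A. ?N a) = {(a, b) \<in> A \<times> B. cell f s {a, b} \<in> P}" by auto
  also have "card \<dots> \<le> card P * s\<^sup>2"
    by (rule card_edges_in_cells) (use assms in auto)
  also have "\<dots> \<le> M * s\<^sup>2" using assms(8) by simp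
  finally have "(\<Sum>a\<in>A. real (card (?N a))) \<le> real (M * s\<^sup>2)"
    by (simp only: of_nat_sum[symmetric] of_nat_le_iff)
  then have "(\<Prod>a\<in>A. real (card (?N a))) \<le> (real (M * s\<^sup>2) / card A) ^ card A"
    using A assms(1,2) by (intro prod_le_mean_power) auto
  then have "(\<Prod>a\<in>A. real (card (?N a))) ^ d \<le> ((real (M * s\<^sup>2) / card A) ^ card A) ^ d"
    by (intro power_mono) (auto intro: prod_nonneg)
  moreover have "real (card ?X) \<le> (\<Prod>a\<in>A. real (card (?N a))) ^ d"
    using 1 by (simp only: of_nat_prod[symmetric] of_nat_power[symmetric] of_nat_le_iff)
  ultimately show ?thesis using assms(1) by (simp only: power_mult[symmetric] mult.commute)
qed

text \<open>Union bound over positions and covers. Assumption \<open>few\<close> is the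
  \<open>n\<close>-th root of the inequality that contradicts the total of
  \<open>n ^ (d * n)\<close> choices: \<open>(2 * n) ^ 2\<close> comes from the orderings and
  \<open>16 ^ d\<close> from the covers.\<close>

lemma exists_choice_graph_queue_number_gt:
  fixes A B :: "'a set" and n k d s N :: nat
  assumes AB: "card A = n" "card B = n" "A \<inter> B = {}" and "n > 0" "s > 0" and N: "2 * n \<le> N * s"
    and few: "(2 * real n) ^ 2 * 16 ^ d * (2 * real N * k * (real s)\<^sup>2 / n) ^ d < real n ^ d"
    and Nk: "N * k \<le> 2 * n * d"
  shows "\<exists>F \<in> A \<times> {..<d} \<rightarrow> B. queue_number (A \<union> B) (choice_graph A d F) > k"
proof (rule ccontr)
  assume neg: "\<not> ?thesis"
  have fin: "finite A" "finite B" using AB \<open>n > 0\<close> card_gt_0_iff by metis+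
  have V: "card (A \<union> B) = 2 * n" using card_Un_disjoint[OF fin AB(3)] AB by simp
  have "N > 0" using N \<open>n > 0\<close> by (cases N) auto
  from chains_cover_exists[OF this, of k]
  obtain \<P> where \<P>: "finite \<P>" "card \<P> \<le> 4 ^ (N * k)"
      "\<forall>P\<in>\<P>. finite P \<and> card P \<le> 2 * N * k"
    and cover: "\<forall>\<C>. finite \<C> \<longrightarrow> card \<C> \<le> k \<longrightarrow> (\<forall>C\<in>\<C>. grid_chain C \<and> C \<subseteq> {..<N} \<times> {..<N}) \<longrightarrow>
      (\<exists>P\<in>\<P>. \<Union>\<C> \<subseteq> P)"
    by (elim exE conjE)
  let ?W = "PiE (A \<times> {..<d}) (\<lambda>_. B)"
  let ?pos = "PiE (A \<union> B) (\<lambda>_. {..<2 * n})"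
  let ?inj = "{f \<in> ?pos. inj_on f (A \<union> B)}"
  let ?X = "\<lambda>(f, P). {F \<in> ?W. cell f s ` choice_graph A d F \<subseteq> P}"
  let ?b = "((real (2 * N * k * s\<^sup>2) / n) ^ d) ^ n"
  have fpos: "finite ?pos" using fin by (intro finite_PiE) auto
  have "card ?inj \<le> card ?pos" using fpos by (intro card_mono) auto
  also have "\<dots> = (2 * n) ^ (2 * n)" using fin V by (simp add: card_PiE)
  finally have inj: "card ?inj \<le> (2 * n) ^ (2 * n)" .
  have "?W \<subseteq> (\<Union>x\<in>?inj \<times> \<P>. ?X x)"
  proof
    fix F assume F: "F \<in> ?W"
    then have F': "F \<in> A \<times> {..<d} \<rightarrow> B" by auto
    then have "queue_number (A \<union> B) (choice_graph A d F) \<le> k" using neg by auto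
    from queue_number_cell_cover[OF simple_graph_choice_graph[OF fin AB(3) F'] this cover, of s]
    obtain f P where "f \<in> ?pos" "inj_on f (A \<union> B)" "P \<in> \<P>" "cell f s ` choice_graph A d F \<subseteq> P"
      using V N by auto
    then show "F \<in> (\<Union>x\<in>?inj \<times> \<P>. ?X x)" using F by auto
  qed
  moreover have "finite (\<Union>x\<in>?inj \<times> \<P>. ?X x)"
  proof (intro finite_UN_I)
    have "finite ?W" using fin by (intro finite_PiE) auto
    then show "finite (?X x)" for x by (cases x) simp
    show "finite (?inj \<times> \<P>)" using fpos \<P>(1) by simp
  qed
  ultimately have "card ?W \<le> card (\<Union>x\<in>?inj \<times> \<P>. ?X x)" by (rule card_mono[rotated])
  also have "\<dots> \<le> (\<Sum>x\<in>?inj \<times> \<P>. card (?X x))"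
    using fpos \<P>(1) by (intro card_UN_le) auto
  finally have "real (card ?W) \<le> (\<Sum>x\<in>?inj \<times> \<P>. real (card (?X x)))"
    by (simp only: of_nat_sum[symmetric] of_nat_le_iff)
  also have "\<dots> \<le> (\<Sum>x\<in>?inj \<times> \<P>. ?b)"
  proof (rule sum_mono)
    fix x assume "x \<in> ?inj \<times> \<P>"
    then obtain f P where x: "x = (f, P)" "inj_on f (A \<union> B)" "P \<in> \<P>" by blast
    then show "real (card (?X x)) \<le> ?b"
      using card_choices_in_cells[OF AB(1) \<open>n > 0\<close> fin(2) AB(3) \<open>s > 0\<close> x(2), of P "2 * N * k" d] bspec[OF \<P>(3) x(3)]
      by simp
  qed
  also have "\<dots> = real (card ?inj) * real (card \<P>) * ?b"
    by (simp add: card_cartesian_product)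
  \<comment> \<open>By \<open>Nk\<close> the number of covers is at most an \<open>n\<close>-th
    power, like the other two factors.\<close>
  also have "\<dots> \<le> (2 * real n) ^ (2 * n) * 4 ^ (2 * n * d) * ?b"
  proof (intro mult_right_mono mult_mono)
    show "real (card ?inj) \<le> (2 * real n) ^ (2 * n)" using of_nat_mono[OF inj, where 'a=real] by simp
    have "real (card \<P>) \<le> 4 ^ (N * k)" using of_nat_mono[OF \<P>(2), where 'a=real] by simp
    also have "\<dots> \<le> 4 ^ (2 * n * d)" by (rule power_increasing) (use Nk in auto)
    finally show "real (card \<P>) \<le> 4 ^ (2 * n * d)" .
  qed auto
  also have "\<dots> = ((2 * real n) ^ 2 * 16 ^ d * (2 * real N * k * (real s)\<^sup>2 / n) ^ d) ^ n"
  proof -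
    have "2 * n * d = 2 * (d * n)" by simp
    then have "(4::real) ^ (2 * n * d) = ((4 ^ 2) ^ d) ^ n" by (simp only: power_mult)
    then have "(4::real) ^ (2 * n * d) = (16 ^ d) ^ n" by simp
    moreover have "(2 * real n) ^ (2 * n) = ((2 * real n) ^ 2) ^ n" by (rule power_mult)
    ultimately show ?thesis by (simp add: power_mult_distrib)
  qed
  also have "\<dots> < (real n ^ d) ^ n"
    by (rule power_strict_mono[OF few]) (use \<open>n > 0\<close> in auto)
  also have "\<dots> = real (card ?W)"
    using fin AB by (simp add: card_PiE card_cartesian_product power_mult[symmetric] mult.commute)
  finally show False by simp
qed

section \<open>Choice of the parameters\<close>

lemma exists_small_local_queue_number_large_queue_number:
  fixes n d :: nat
  defines "\<kappa> \<equiv> 1 / 128 * sqrt d * real (2 * n) powr (1 / 2 - 1 / d)"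
  assumes "d \<ge> 3" "n > 0" and large: "\<kappa> \<ge> d / 2"
  shows "\<exists>(V::nat set) E. simple_graph V E \<and> card V = 2 * n \<and>
    local_queue_number V E \<le> d \<and> real (queue_number V E) \<ge> \<kappa>"
proof -
  define k where "k = nat \<lfloor>\<kappa>\<rfloor>"
  \<comment> \<open>Rounding up gives \<open>k \<le> s * d / 2\<close>. With
    \<open>N * s \<le> 4 * n\<close> this yields \<open>N * k \<le> 2 * n * d\<close>.\<close>
  define s where "s = nat \<lceil>2 * \<kappa> / d\<rceil>"
  \<comment> \<open>The extra block covers the remainder when \<open>s\<close> does not divide
    \<open>2 * n\<close>.\<close>
  define N where "N = 2 * n div s + 1"
  have d: "real d \<ge> 3" and n: "real n \<ge> 1" using assms by auto
  have \<kappa>: "\<kappa> > 0" using large d by linarith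
  have k: "real k \<le> \<kappa>" using \<kappa> by (simp add: k_def)
  have s_lower: "2 * \<kappa> / d \<le> real s" unfolding s_def by (rule real_nat_ceiling_ge)
  have quot: "2 * \<kappa> / d \<ge> 1" using large d by (simp add: field_simps)
  then have s_pos: "s > 0" using s_lower by linarith
  have "real s \<le> 2 * \<kappa> / d + 1" using quot unfolding s_def by linarith
  \<comment> \<open>By \<open>large\<close> the unrounded value is at least 1, so rounding at most
    doubles it.\<close>
  then have s_upper: "real s \<le> 4 * \<kappa> / d" using quot by linarith
  \<comment> \<open>A crude bound on \<open>\<kappa>\<close> suffices for
    \<open>s \<le> 2 * n\<close>, which keeps \<open>N * s\<close> below \<open>4 * n\<close>
    despite the extra block.\<close>
  have "real (2 * n) powr (1 / 2 - 1 / d) \<le> real (2 * n) powr 1"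
    using n d by (intro powr_mono) (auto simp: field_simps)
  then have "\<kappa> \<le> 1 / 128 * sqrt d * (2 * n)"
    unfolding \<kappa>_def by (intro mult_left_mono) auto
  also have "\<dots> \<le> 1 / 128 * d * (2 * n)"
    using d by (intro mult_right_mono mult_left_mono) (auto intro!: real_le_lsqrt simp: power2_eq_square)
  also have "\<dots> \<le> d * n / 2" using d n by simp
  finally have "4 * \<kappa> / d \<le> 2 * n" using d by (simp add: field_simps)
  then have s_n: "real s \<le> 2 * n" using s_upper by linarith
  have "2 * n < N * s"
    using s_pos dividend_less_times_div[of s "2 * n"] by (simp add: N_def algebra_simps)
  have "(2 * n div s) * s \<le> 2 * n" by (rule div_times_less_eq_dividend)
  then have "N * s \<le> 2 * n + s" by (simp add: N_def)
  then have "real (N * s) \<le> real (2 * n + s)" by (simp only: of_nat_le_iff)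
  then have Ns: "real N * real s \<le> 4 * n" using s_n by simp
  have "\<kappa> \<le> real s * d / 2" using s_lower d by (simp add: field_simps)
  then have "real N * k \<le> real N * (real s * d / 2)" using k by (intro mult_left_mono) auto
  also have "\<dots> = real N * real s * (d / 2)" by simp
  also have "\<dots> \<le> 4 * n * (d / 2)" by (intro mult_right_mono Ns) auto
  finally have "real (N * k) \<le> real (2 * n * d)" by (simp add: mult_ac)
  then have Nk: "N * k \<le> 2 * n * d" by (simp only: of_nat_le_iff)
  \<comment> \<open>Up to a constant, \<open>x\<close> is \<open>\<kappa>\<^sup>2 / d\<close>. Its
    \<open>d\<close>-th power is \<open>(2 * n) ^ (d - 2)\<close>, so the factor
    \<open>(2 * n) ^ 2\<close> for the orderings is absorbed exactly. This is the source of the loss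
    \<open>1 / d\<close> in the exponent.\<close>
  define x where "x = real (2 * n) powr (1 - 2 / d)"
  have "(real (2 * n) powr (1 / 2 - 1 / d))\<^sup>2 = x"
    using n d by (simp add: x_def powr_power algebra_simps)
  then have \<kappa>2: "\<kappa>\<^sup>2 = d * x / 16384"
    by (simp add: \<kappa>_def power_mult_distrib power_divide)
  have "2 * real N * k * (real s)\<^sup>2 / n = 2 * (real N * real s) * (k * real s) / n"
    by (simp add: power2_eq_square)
  also have "\<dots> \<le> 2 * (4 * n) * (\<kappa> * (4 * \<kappa> / d)) / n"
    using k s_upper Ns \<kappa> by (intro divide_right_mono mult_mono) auto
  also have "\<dots> = 32 * \<kappa>\<^sup>2 / d" using n by (simp add: power2_eq_square)
  also have "\<dots> = x / 512" using d by (simp add: \<kappa>2)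
  finally have M: "2 * real N * k * (real s)\<^sup>2 / n \<le> x / 512" .
  have "x ^ d = real (2 * n) powr (d * (1 - 2 / d))"
    using n unfolding x_def by (subst powr_realpow[symmetric]) (simp_all add: powr_powr mult.commute)
  also have "d * (1 - 2 / d) = real d - 2" using d by (simp add: field_simps)
  also have "real (2 * n) powr (real d - 2) = real (2 * n) ^ d / real (2 * n) ^ 2"
    using n by (simp add: powr_diff powr_realpow)
  finally have x: "real (2 * n) ^ 2 * x ^ d = real (2 * n) ^ d" using n by simp
  have "(2 * real n) ^ 2 * 16 ^ d * (2 * real N * k * (real s)\<^sup>2 / n) ^ d
      \<le> (2 * real n) ^ 2 * 16 ^ d * (x / 512) ^ d"
    by (intro mult_left_mono power_mono M) auto
  also have "16 ^ d * (x / 512) ^ d = x ^ d * (16 / 512) ^ d"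
    unfolding power_mult_distrib[symmetric] by simp
  then have "(2 * real n) ^ 2 * 16 ^ d * (x / 512) ^ d = (real (2 * n) ^ 2 * x ^ d) * (16 / 512) ^ d"
    by simp
  also have "\<dots> = (real (2 * n) * (16 / 512)) ^ d"
    unfolding x by (simp only: power_mult_distrib)
  \<comment> \<open>The constant 128 gives 16384 = 128 * 128 and then 32 / 16384 = 1 / 512, so the
    base here is \<open>n / 16\<close>.\<close>
  also have "\<dots> < real n ^ d" using n d by (intro power_strict_mono) auto
  finally have few: "(2 * real n) ^ 2 * 16 ^ d * (2 * real N * k * (real s)\<^sup>2 / n) ^ d < real n ^ d" .
  let ?A = "{..<n}" and ?B = "{n..<2 * n}"
  have AB: "card ?A = n" "card ?B = n" "?A \<inter> ?B = {}" by auto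
  obtain F where F: "F \<in> ?A \<times> {..<d} \<rightarrow> ?B" and q: "queue_number (?A \<union> ?B) (choice_graph ?A d F) > k"
    using exists_choice_graph_queue_number_gt[OF AB \<open>n > 0\<close> s_pos less_imp_le[OF \<open>2 * n < N * s\<close>] few Nk]
    by blast
  \<comment> \<open>An integer above the floor of \<open>\<kappa>\<close> is at least
    \<open>\<kappa>\<close>.\<close>
  have "real (queue_number (?A \<union> ?B) (choice_graph ?A d F)) \<ge> \<kappa>"
    using q \<kappa> unfolding k_def by linarith
  moreover have "card (?A \<union> ?B) = 2 * n" by (subst card_Un_disjoint) auto
  moreover have "simple_graph (?A \<union> ?B) (choice_graph ?A d F)"
    by (rule simple_graph_choice_graph[OF _ _ AB(3) F]) auto
  moreover have "local_queue_number (?A \<union> ?B) (choice_graph ?A d F) \<le> d"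
    by (rule local_queue_number_choice_graph[OF _ _ AB(3) F]) (use assms in auto)
  ultimately show ?thesis by blast
qed

text \<open>The construction even gives local queue number at most \<open>d\<close>. The orders
  obtained are the even numbers \<open>2 * n\<close> with \<open>n\<close> large enough for
  \<open>\<kappa> \<ge> d / 2\<close>.\<close>

theorem theorem1:
  shows "\<exists>c::real. c > 0 \<and>
    (\<forall>d::nat. d \<ge> 3 \<longrightarrow>
      infinite {n::nat. \<exists>(V::nat set) E.
        simple_graph V E \<and> card V = n \<and>
        local_queue_number V E \<le> d + 2 \<and>
        real (queue_number V E) \<ge> c * sqrt (real d) * real n powr (1/2 - 1 / real d)})"
proof (intro exI[of _ "1 / 128"] conjI allI impI)
  fix d :: nat assume d: "d \<ge> 3"
  let ?e = "1 / 2 - 1 / real d"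
  have e: "?e > 0" using d by (simp add: field_simps)
  \<comment> \<open>From \<open>n0\<close> on, \<open>(2 * n) powr ?e\<close> is at least
    \<open>64 * sqrt d\<close>, and multiplying by \<open>sqrt d / 128\<close> gives
    \<open>d / 2\<close>. Positivity of \<open>?e\<close> needs \<open>d \<ge> 3\<close>.\<close>
  define n0 where "n0 = nat \<lceil>(64 * sqrt d) powr (1 / ?e)\<rceil>"
  have n0: "1 / 128 * sqrt d * real (2 * n) powr ?e \<ge> d / 2" if "n \<ge> n0" for n
  proof -
    have "(64 * sqrt d) powr (1 / ?e) \<le> real (2 * n)"
      using that unfolding n0_def by linarith
    then have "((64 * sqrt d) powr (1 / ?e)) powr ?e \<le> real (2 * n) powr ?e"
      using e by (intro powr_mono2) auto
    moreover have "((64 * sqrt d) powr (1 / ?e)) powr ?e = 64 * sqrt d"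
      using e d by (simp add: powr_powr)
    ultimately have "1 / 128 * sqrt d * (64 * sqrt d) \<le> 1 / 128 * sqrt d * real (2 * n) powr ?e"
      by (intro mult_left_mono) auto
    then show ?thesis by simp
  qed
  show "infinite {n::nat. \<exists>(V::nat set) E.
        simple_graph V E \<and> card V = n \<and>
        local_queue_number V E \<le> d + 2 \<and>
        real (queue_number V E) \<ge> 1 / 128 * sqrt (real d) * real n powr ?e}"
    unfolding infinite_nat_iff_unbounded_le
  proof (intro allI)
    fix m :: nat
    \<comment> \<open>Large enough for \<open>n0\<close> and for order \<open>2 * n \<ge> m\<close>;
      the summand 1 makes \<open>n\<close> positive.\<close>
    define n where "n = m + n0 + 1"
    have "m \<le> 2 * n" by (simp add: n_def)
    have "n \<ge> n0" "n > 0" by (auto simp: n_def)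
    from exists_small_local_queue_number_large_queue_number[OF d this(2) n0[OF this(1)]]
    obtain V :: "nat set" and E where "simple_graph V E" "card V = 2 * n" "local_queue_number V E \<le> d"
      "real (queue_number V E) \<ge> 1 / 128 * sqrt d * real (2 * n) powr ?e"
      by blast
    then show "\<exists>n\<ge>m. n \<in> {n::nat. \<exists>(V::nat set) E.
        simple_graph V E \<and> card V = n \<and>
        local_queue_number V E \<le> d + 2 \<and>
        real (queue_number V E) \<ge> 1 / 128 * sqrt (real d) * real n powr ?e}"
      using \<open>m \<le> 2 * n\<close> by (intro exI[of _ "2 * n"] conjI CollectI exI[of _ V] exI[of _ E]) auto
  qed
qed simp

end
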